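(* Let $(V_1,F_1)$ and $(V_2,F_2)$ be Minkowski normed spaces and let $\mu:V_1\to V_2$ be a surjective linear map. Then the following statements are equivalent: (i) $\mu$ is a Minkowski submersion. (ii) $\mu(\overline{B_{F_1}})=\overline{B_{F_2}}$. (iii) For all $v\in V_2$, $F_2(v)=\inf\{F_1(u) : u\in V_1,\ \mu(u)=v\}$.
   Context: Vector spaces are real and finite-dimensional. A Minkowski norm $F$ on a vector space $V$ is a non-negative real-valued function that is $C^\infty$ on $V\setminus\{0\}$, positively homogeneous ($F(\lambda u)=\lambda F(u)$ for $\lambda>0$, with $F(0)=0$), and strongly convex: the Hessian matrix $\left(\frac{\partial^2 (\frac12F^2)}{\partial u^a\partial u^b}(u)\right)$ in linear coordinates is positive definite for each $u\in V\setminus\{0\}$. The pair $(V,F)$ is a Minkowski normed space. Write $B_F=\{u\in V: F(u)<1\}$ for the open unit ball and $\overline{B_F}$ for its closure, the closed unit ball $\{u : F(u)\le1\}$. A surjective linear map $\mu:V_1\to V_2$ between Minkowski normed spaces is by definition a submersion between Minkowski normed spaces (Minkowski submersion) if $\mu(\overline{B_{F_1}})=\overline{B_{F_2}}$ (so (i) and (ii) are equivalent by definition). *)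

theory Defs
  imports "HOL-Analysis.Analysis"
begin

text \<open>
  A finite-dimensional real vector space is a type of class \<open>real_normed_vector\<close> spanned by a
  finite set. The class norm only provides the topology and the notion of derivative, neither of
  which depends on the choice of norm in finite dimension. Unlike \<open>euclidean_space\<close>, this does not
  exclude the zero space.
\<close>

definition finite_dim :: "'a::real_normed_vector itself \<Rightarrow> bool" where
  "finite_dim _ \<longleftrightarrow> (\<exists>B :: 'a set. finite B \<and> span B = UNIV)"

definition linear_basis :: "'a::real_normed_vector set \<Rightarrow> bool" where
  "linear_basis B \<longleftrightarrow> finite B \<and> independent B \<and> span B = UNIV"

definition dir_deriv :: "'a::real_normed_vector \<Rightarrow> ('a \<Rightarrow> real) \<Rightarrow> 'a \<Rightarrow> real" where
  "dir_deriv v f = (\<lambda>x. frechet_derivative f (at x) v)"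

text \<open>Intended for open sets in finite-dimensional spaces only.\<close>

primrec Ck_on :: "nat \<Rightarrow> 'a::real_normed_vector set \<Rightarrow> ('a \<Rightarrow> real) \<Rightarrow> bool" where
  "Ck_on 0 S f \<longleftrightarrow> continuous_on S f"
| "Ck_on (Suc k) S f \<longleftrightarrow> f differentiable_on S \<and> (\<forall>v. Ck_on k S (dir_deriv v f))"

definition Cinf_on :: "'a::real_normed_vector set \<Rightarrow> ('a \<Rightarrow> real) \<Rightarrow> bool" where
  "Cinf_on S f \<longleftrightarrow> (\<forall>k. Ck_on k S f)"

text \<open>
  In the linear coordinates given by a basis \<open>B\<close>, the partial derivatives are the directional
  derivatives along the elements of \<open>B\<close>, so the Hessian matrix at \<open>u\<close> is indexed by \<open>B\<close> itself.
\<close>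

definition hessian :: "('a::real_normed_vector \<Rightarrow> real) \<Rightarrow> 'a \<Rightarrow> 'a \<Rightarrow> 'a \<Rightarrow> real" where
  "hessian f u a b = dir_deriv a (dir_deriv b f) u"

definition pos_def_matrix_on :: "'i set \<Rightarrow> ('i \<Rightarrow> 'i \<Rightarrow> real) \<Rightarrow> bool" where
  "pos_def_matrix_on B M \<longleftrightarrow>
     (\<forall>a\<in>B. \<forall>b\<in>B. M a b = M b a) \<and>
     (\<forall>c. (\<exists>b\<in>B. c b \<noteq> 0) \<longrightarrow> 0 < (\<Sum>a\<in>B. \<Sum>b\<in>B. c a * M a b * c b))"

definition minkowski_norm :: "('a::real_normed_vector \<Rightarrow> real) \<Rightarrow> bool" where
  "minkowski_norm F \<longleftrightarrow>
     (\<forall>u. 0 \<le> F u) \<and>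
     Cinf_on (UNIV - {0}) F \<and>
     F 0 = 0 \<and>
     (\<forall>l u. 0 < l \<longrightarrow> F (l *\<^sub>R u) = l * F u) \<and>
     (\<forall>B u. linear_basis B \<and> u \<noteq> 0 \<longrightarrow>
        pos_def_matrix_on B (hessian (\<lambda>x. 1/2 * (F x)\<^sup>2) u))"

definition minkowski_normed_space :: "('a::real_normed_vector \<Rightarrow> real) \<Rightarrow> bool" where
  "minkowski_normed_space F \<longleftrightarrow> finite_dim TYPE('a) \<and> minkowski_norm F"

definition unit_ball :: "('a::real_normed_vector \<Rightarrow> real) \<Rightarrow> 'a set" where
  "unit_ball F = {u. F u < 1}"

definition minkowski_submersion ::
  "('a::real_normed_vector \<Rightarrow> real) \<Rightarrow> ('b::real_normed_vector \<Rightarrow> real) \<Rightarrow> ('a \<Rightarrow> 'b) \<Rightarrow> bool" where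
  "minkowski_submersion F\<^sub>1 F\<^sub>2 \<mu> \<longleftrightarrow>
     linear \<mu> \<and> surj \<mu> \<and> \<mu> ` closure (unit_ball F\<^sub>1) = closure (unit_ball F\<^sub>2)"

end

theory Submission
  imports Defs
begin

text \<open>
  Both sides of the equivalence reduce, by homogeneity, to comparing $F_2(\mu(u))$ with $F_1(u)$.
  That the closed balls match says that $F_2(\mu(u)) \le F_1(u)$ and that every $v$ has a preimage
  $u$ with $F_1(u) \le F_2(v)$, i.e. that the infimum over each fibre equals $F_2(v)$ and is
  attained. Attainment is automatic by compactness: strong convexity makes a Minkowski norm
  positive off $0$, since its Hessian satisfies $\partial_u \partial_u (\frac12 F^2)(u) = 0$
  whenever $F(u) = 0$; as spheres are compact, $F$ is then equivalent to the norm. The same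
  equivalence shows that $F_2 \circ \mu \le F_1$ forces $\mu$ to be continuous.
\<close>

section \<open>Compactness of balls in finite-dimensional spaces\<close>

text \<open>Induction on \<open>B\<close>: a vector of norm at most \<open>r\<close> splits as
  \<open>t *\<^sub>R a + y\<close> with \<open>t\<close> and \<open>y\<close> bounded, so the new
  slice is a closed part of a compact sum. The radius stays general because \<open>y\<close> may be
  longer than \<open>r\<close>.\<close>

lemma compact_cball_Int_span:
  fixes B :: "'a::real_normed_vector set"
  assumes "finite B"
  shows "compact (cball 0 r \<inter> span B)"
  using assms
proof (induction B arbitrary: r rule: finite_induct)
  case empty
  have "cball 0 r \<inter> {0::'a} = {} \<or> cball 0 r \<inter> {0::'a} = {0}" by auto
  then show ?case by auto
next
  case (insert a B)
  \<comment> \<open>A convergent sequence is bounded, so it lies in one compact slice of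
    \<open>span B\<close>, which contains its limit.\<close>
  have closed: "closed (span B)"
    unfolding closed_sequential_limits
  proof (intro allI impI)
    fix x l assume x: "(\<forall>n. x n \<in> span B) \<and> x \<longlonglongrightarrow> l"
    then obtain K where "\<And>n. norm (x n) \<le> K"
      by (meson BseqE convergent_def convergent_imp_Bseq)
    then have "\<And>n. x n \<in> cball 0 K \<inter> span B" using x by simp
    then have "l \<in> cball 0 K \<inter> span B"
      using closed_sequentially[OF compact_imp_closed[OF insert.IH]] x by blast
    then show "l \<in> span B" by simp
  qed
  show ?case
  proof (cases "a \<in> span B")
    case True
    then show ?thesis using insert.IH by (simp add: span_redundant)
  next
    case False
    \<comment> \<open>\<open>d\<close> bounds the distance from \<open>a\<close> to
      \<open>span B\<close> from below; it will control the coefficient of \<open>a\<close>.\<close>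
    then obtain d where d: "d > 0" "ball a d \<subseteq> - span B"
      using closed open_contains_ball[of "- span B"] by (auto simp: open_Compl)
    define C where "C = {x + y |x y. x \<in> (\<lambda>t. t *\<^sub>R a) ` {-(r/d)..r/d} \<and>
                                     y \<in> cball 0 (r + r/d * norm a) \<inter> span B}"
    have "compact C"
      unfolding C_def
      by (intro compact_sums insert.IH compact_continuous_image continuous_intros) auto
    moreover have "C \<subseteq> span (insert a B)"
    proof
      fix z assume "z \<in> C"
      then obtain t y where "z = t *\<^sub>R a + y" "y \<in> span B" by (auto simp: C_def)
      then show "z \<in> span (insert a B)"
        by (metis add_diff_cancel_left' span_breakdown_eq)
    qed
    moreover have "cball 0 r \<inter> span (insert a B) \<subseteq> C"
    proof
      fix z assume z: "z \<in> cball 0 r \<inter> span (insert a B)"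
      then obtain t where t: "z - t *\<^sub>R a \<in> span B" by (auto simp: span_breakdown_eq)
      have zr: "norm z \<le> r" using z by simp
      have "\<bar>t\<bar> * d \<le> norm z"
      proof (cases "t = 0")
        case False
        \<comment> \<open>This point of \<open>span B\<close> equals
          \<open>a - (1/t) *\<^sub>R z\<close>, so its distance from \<open>a\<close> is
          \<open>norm z / \<bar>t\<bar>\<close>, which is at least \<open>d\<close>.\<close>
        have "(-1/t) *\<^sub>R (z - t *\<^sub>R a) \<in> span B" using t span_scale by blast
        then have "(-1/t) *\<^sub>R (z - t *\<^sub>R a) \<notin> ball a d" using d by blast
        moreover have "a - (-1/t) *\<^sub>R (z - t *\<^sub>R a) = (1/t) *\<^sub>R z"
          using False by (simp add: algebra_simps)
        ultimately have "d \<le> norm ((1/t) *\<^sub>R z)" by (simp add: dist_norm)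
        then show ?thesis using False by (simp add: field_simps)
      qed simp
      then have tb: "\<bar>t\<bar> \<le> r / d" using d zr by (simp add: field_simps)
      have "norm (z - t *\<^sub>R a) \<le> norm z + \<bar>t\<bar> * norm a"
        using norm_triangle_ineq4[of z "t *\<^sub>R a"] by simp
      also have "\<dots> \<le> r + r/d * norm a"
        using zr tb by (intro add_mono mult_right_mono) auto
      finally have "z - t *\<^sub>R a \<in> cball 0 (r + r/d * norm a) \<inter> span B" using t by simp
      moreover have "t *\<^sub>R a \<in> (\<lambda>t. t *\<^sub>R a) ` {-(r/d)..r/d}" using tb by (intro imageI) (simp add: abs_le_iff)
      ultimately show "z \<in> C" unfolding C_def by force
    qed
    ultimately have "cball 0 r \<inter> span (insert a B) = cball 0 r \<inter> C" by blast
    then show ?thesis using \<open>compact C\<close> by (simp add: closed_Int_compact)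
  qed
qed

lemma finite_dim_compact_cball:
  assumes "finite_dim TYPE('a::real_normed_vector)"
  shows "compact (cball (0::'a) r)"
proof -
  obtain B :: "'a set" where "finite B" "span B = UNIV"
    using assms by (auto simp: finite_dim_def)
  then show ?thesis using compact_cball_Int_span[of B r] by simp
qed

text \<open>Strong convexity speaks of Hessian matrices in bases; putting \<open>u\<close> into the
  basis makes the second derivative along \<open>u\<close> a diagonal entry.\<close>

lemma finite_dim_linear_basis_containing:
  assumes "finite_dim TYPE('a::real_normed_vector)" and "u \<noteq> (0::'a)"
  obtains B where "linear_basis B" "u \<in> B"
proof -
  obtain T :: "'a set" where T: "finite T" "span T = UNIV"
    using assms by (auto simp: finite_dim_def)
  have "independent {u}" using assms by simp
  then obtain B where B: "{u} \<subseteq> B" "independent B" "UNIV \<subseteq> span B"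
    using maximal_independent_subset_extend[of "{u}" UNIV] by auto
  then have "finite B" using independent_span_bound[of T B] T by simp
  then show ?thesis using that[of B] B by (auto simp: linear_basis_def)
qed

section \<open>Derivatives of homogeneous functions and of half squares\<close>

text \<open>Euler's identity in degree one: compare the chain rule for
  \<open>F (t *\<^sub>R u)\<close> at \<open>t = 1\<close> with the derivative of
  \<open>t * F u\<close>, which is the same function on the positive half-line.\<close>

lemma homogeneous_dir_deriv_self:
  fixes F :: "'a::real_normed_vector \<Rightarrow> real"
  assumes hom: "\<And>l u. 0 < l \<Longrightarrow> F (l *\<^sub>R u) = l * F u"
    and diff: "F differentiable (at u)"
  shows "dir_deriv u F u = F u"
proof -
  have "(F has_derivative frechet_derivative F (at u)) (at (1 *\<^sub>R u))"
    using diff by (simp add: frechet_derivative_works)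
  moreover have "((\<lambda>t. t *\<^sub>R u) has_derivative (\<lambda>t. t *\<^sub>R u)) (at (1::real))"
    by (auto intro!: derivative_eq_intros)
  ultimately have "((\<lambda>t. F (t *\<^sub>R u)) has_derivative (\<lambda>t. frechet_derivative F (at u) (t *\<^sub>R u)))
      (at (1::real))"
    by (rule has_derivative_compose[rotated])
  moreover have "((\<lambda>t. F (t *\<^sub>R u)) has_derivative (\<lambda>t. t * F u)) (at (1::real))"
  proof (rule has_derivative_transform_within_open)
    show "((\<lambda>t. t * F u) has_derivative (\<lambda>t. t * F u)) (at (1::real))"
      by (auto intro!: derivative_eq_intros)
    show "open {0::real<..}" "1 \<in> {0::real<..}" by auto
  qed (simp add: hom)
  ultimately have "(\<lambda>t. frechet_derivative F (at u) (t *\<^sub>R u)) = (\<lambda>t. t * F u)"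
    by (rule has_derivative_unique)
  from fun_cong[OF this, of 1] show ?thesis by (simp add: dir_deriv_def)
qed

text \<open>By the product rule the Hessian is \<open>F u\<close> times the second derivative of
  \<open>F\<close> plus the product of two first derivatives; the former term vanishes with
  \<open>F u\<close>.\<close>

lemma hessian_half_square_at_zero:
  fixes F :: "'a::real_normed_vector \<Rightarrow> real"
  assumes smooth: "Ck_on 2 S F" and S: "open S" "u \<in> S" and "F u = 0"
  shows "hessian (\<lambda>x. 1/2 * (F x)\<^sup>2) u a b = dir_deriv a F u * dir_deriv b F u"
proof -
  have F: "F differentiable (at x)" if "x \<in> S" for x
    using smooth S that by (simp add: numeral_2_eq_2 differentiable_on_eq_differentiable_at)
  have D: "dir_deriv b F differentiable (at u)"
    using smooth S by (simp add: numeral_2_eq_2 differentiable_on_eq_differentiable_at)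
  have F': "(F has_derivative frechet_derivative F (at x)) (at x)" if "x \<in> S" for x
    using F[OF that] by (simp add: frechet_derivative_works)
  have first: "dir_deriv b (\<lambda>x. 1/2 * (F x)\<^sup>2) x = F x * dir_deriv b F x" if "x \<in> S" for x
  proof -
    have "((\<lambda>x. 1/2 * (F x)\<^sup>2) has_derivative (\<lambda>h. F x * frechet_derivative F (at x) h)) (at x)"
      by (rule derivative_eq_intros refl F'[OF that])+ (simp add: fun_eq_iff)
    then show ?thesis unfolding dir_deriv_def by (metis frechet_derivative_at)
  qed
  have "((\<lambda>x. F x * dir_deriv b F x) has_derivative
      (\<lambda>h. F u * frechet_derivative (dir_deriv b F) (at u) h
         + frechet_derivative F (at u) h * dir_deriv b F u)) (at u)"
    using F'[OF \<open>u \<in> S\<close>] D by (intro has_derivative_mult) (simp_all add: frechet_derivative_works)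
  then have "(dir_deriv b (\<lambda>x. 1/2 * (F x)\<^sup>2) has_derivative
      (\<lambda>h. F u * frechet_derivative (dir_deriv b F) (at u) h
         + frechet_derivative F (at u) h * dir_deriv b F u)) (at u)"
    by (rule has_derivative_transform_within_open[OF _ S]) (rule first[symmetric])
  from fun_cong[OF frechet_derivative_at[OF this], of a] show ?thesis
    using \<open>F u = 0\<close> by (simp add: hessian_def dir_deriv_def)
qed

section \<open>Minkowski norms: positivity, comparison with the norm, topology\<close>

context
  fixes F :: "'a::real_normed_vector \<Rightarrow> real"
  assumes F: "minkowski_normed_space F"
begin

lemma minkowski_nonneg: "0 \<le> F u"
  and minkowski_zero: "F 0 = 0"
  using F by (auto simp: minkowski_normed_space_def minkowski_norm_def)

lemma minkowski_scale: "0 \<le> l \<Longrightarrow> F (l *\<^sub>R u) = l * F u"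
  using F by (cases "l = 0") (auto simp: minkowski_normed_space_def minkowski_norm_def)

lemma minkowski_compact_cball: "compact (cball (0::'a) r)"
  using F by (simp add: finite_dim_compact_cball minkowski_normed_space_def)

lemma minkowski_pos:
  assumes "u \<noteq> 0"
  shows "0 < F u"
proof (rule ccontr)
  assume "\<not> 0 < F u"
  then have Fu: "F u = 0" using minkowski_nonneg[of u] by simp
  obtain B where B: "linear_basis B" "u \<in> B"
    using finite_dim_linear_basis_containing[OF _ assms] F
    by (auto simp: minkowski_normed_space_def)
  \<comment> \<open>\<open>?c\<close> is the coordinate vector of \<open>u\<close> in
    \<open>B\<close>, so the quadratic form collapses to the entry \<open>?H u u\<close>.\<close>
  let ?H = "hessian (\<lambda>x. 1/2 * (F x)\<^sup>2) u" and ?c = "\<lambda>b. if b = u then 1 else 0 :: real"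
  have C2: "Ck_on 2 (UNIV - {0}) F"
    using F by (simp add: minkowski_normed_space_def minkowski_norm_def Cinf_on_def)
  have "F differentiable_on (UNIV - {0})"
    using C2 by (simp add: numeral_2_eq_2)
  then have "F differentiable (at u)"
    using assms by (simp add: differentiable_on_eq_differentiable_at open_delete)
  then have "dir_deriv u F u = F u"
    by (intro homogeneous_dir_deriv_self) (simp_all add: minkowski_scale)
  then have "?H u u = 0"
    using hessian_half_square_at_zero[OF C2 _ _ Fu] assms Fu by (simp add: open_delete)
  moreover have "pos_def_matrix_on B ?H"
    using F B assms by (simp add: minkowski_normed_space_def minkowski_norm_def)
  then have "0 < (\<Sum>a\<in>B. \<Sum>b\<in>B. ?c a * ?H a b * ?c b)"
    using \<open>u \<in> B\<close> unfolding pos_def_matrix_on_def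
    by (elim conjE allE[of _ ?c]) (auto intro: bexI[of _ u])
  moreover have "(\<Sum>a\<in>B. \<Sum>b\<in>B. ?c a * ?H a b * ?c b) = ?H u u"
    using B by (simp add: if_distrib[of "\<lambda>x. _ * x"] if_distrib[of "\<lambda>x. x * _"] sum.delta
        linear_basis_def cong: if_cong)
  ultimately show False by simp
qed

text \<open>The extreme values of \<open>F\<close> on the unit sphere serve as constants, and
  homogeneity carries the bounds to all vectors. The zero space has an empty sphere and is treated
  apart.\<close>

lemma minkowski_norm_equiv:
  obtains c C where "0 < c" "0 < C" "\<And>u. c * norm u \<le> F u" "\<And>u. F u \<le> C * norm u"
proof (cases "sphere (0::'a) 1 = {}")
  case True
  have trivial: "u = 0" for u :: 'a
  proof (rule ccontr)
    assume "u \<noteq> 0"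
    then have "u /\<^sub>R norm u \<in> sphere 0 1" by simp
    then show False using True by blast
  qed
  then have "1 * norm u \<le> F u" "F u \<le> 1 * norm u" for u
    by (simp_all add: trivial[of u] minkowski_zero)
  then show ?thesis using that[of 1 1] by simp
next
  case False
  have "compact (cball 0 1 \<inter> sphere (0::'a) 1)"
    unfolding sphere_def dist_norm
    by (intro compact_Int_closed minkowski_compact_cball closed_Collect_eq continuous_intros)
  moreover have "cball 0 1 \<inter> sphere (0::'a) 1 = sphere 0 1" by auto
  ultimately have compact: "compact (sphere (0::'a) 1)" by simp
  have "continuous_on (UNIV - {0}) F"
    using F by (metis Cinf_on_def Ck_on.simps(1) minkowski_norm_def minkowski_normed_space_def)
  then have cont: "continuous_on (sphere 0 1) F" by (rule continuous_on_subset) auto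
  obtain p where p: "p \<in> sphere 0 1" "\<And>s. s \<in> sphere 0 1 \<Longrightarrow> F p \<le> F s"
    using continuous_attains_inf[OF compact False cont] by blast
  obtain q where q: "q \<in> sphere 0 1" "\<And>s. s \<in> sphere 0 1 \<Longrightarrow> F s \<le> F q"
    using continuous_attains_sup[OF compact False cont] by blast
  have "F p * norm u \<le> F u \<and> F u \<le> F q * norm u" for u
  proof (cases "u = 0")
    case False
    define s where "s = u /\<^sub>R norm u"
    have s: "s \<in> sphere 0 1" and "u = norm u *\<^sub>R s" using False by (simp_all add: s_def)
    then have "F u = norm u * F s" by (metis minkowski_scale norm_ge_zero)
    then show ?thesis
      using p(2)[OF s] q(2)[OF s] by (simp add: mult.commute[of "norm u"] mult_right_mono)
  qed (simp add: minkowski_zero)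
  moreover have "0 < F p" "0 < F q" using p q by (auto intro!: minkowski_pos)
  ultimately show ?thesis using that by blast
qed

text \<open>Smoothness covers the points off 0; at 0 the bound \<open>F u \<le> C * norm u\<close>
  squeezes \<open>F\<close> to 0.\<close>

lemma minkowski_continuous: "continuous_on UNIV F"
proof -
  have "isCont F u" for u
  proof (cases "u = 0")
    case True
    obtain C where C: "\<And>u. F u \<le> C * norm u" using minkowski_norm_equiv by metis
    have "((\<lambda>u::'a. C * norm u) \<longlongrightarrow> C * norm (0::'a)) (at 0)"
      by (intro tendsto_intros)
    then have "(F \<longlongrightarrow> 0) (at 0)"
      using C minkowski_nonneg
      by (intro tendsto_sandwich[of "\<lambda>_. 0" F "at 0" "\<lambda>u. C * norm u"]) simp_all
    then show ?thesis using True by (simp add: isCont_def minkowski_zero)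
  next
    case False
    have "continuous_on (UNIV - {0}) F"
      using F by (metis Cinf_on_def Ck_on.simps(1) minkowski_norm_def minkowski_normed_space_def)
    then show ?thesis using False by (simp add: continuous_on_eq_continuous_at open_delete)
  qed
  then show ?thesis by (simp add: continuous_at_imp_continuous_on)
qed

lemma minkowski_closure_unit_ball: "closure (unit_ball F) = {u. F u \<le> 1}"
proof
  have "closed {u. F u \<le> 1}"
    using minkowski_continuous by (intro closed_Collect_le) auto
  then show "closure (unit_ball F) \<subseteq> {u. F u \<le> 1}"
    by (intro closure_minimal) (auto simp: unit_ball_def)
  show "{u. F u \<le> 1} \<subseteq> closure (unit_ball F)"
  proof
    fix u assume u: "u \<in> {u. F u \<le> 1}"
    \<comment> \<open>Shrinking \<open>u\<close> by factors below 1 that tend to 1 approaches it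
      from inside the open ball. \<open>Suc n\<close> keeps \<open>r n\<close> nonnegative, as
      \<open>minkowski_scale\<close> requires.\<close>
    define r where "r n = 1 - 1 / real (Suc n)" for n
    have "r \<longlonglongrightarrow> 1 - 0"
      unfolding r_def by (intro tendsto_diff tendsto_const LIMSEQ_Suc[OF lim_1_over_n])
    then have "(\<lambda>n. r n *\<^sub>R u) \<longlonglongrightarrow> 1 *\<^sub>R u" by (intro tendsto_intros) simp
    moreover have "r n *\<^sub>R u \<in> unit_ball F" for n
    proof -
      have r: "0 \<le> r n" "r n < 1" by (auto simp: r_def)
      then have "r n * F u \<le> r n" using u by (simp add: mult_left_le)
      then show ?thesis using r by (simp add: unit_ball_def minkowski_scale)
    qed
    ultimately show "u \<in> closure (unit_ball F)"
      unfolding closure_sequential by (intro exI[of _ "\<lambda>n. r n *\<^sub>R u"]) simp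
  qed
qed

lemma minkowski_compact_sublevel: "compact {u. F u \<le> r}"
proof -
  obtain c where c: "0 < c" "\<And>u. c * norm u \<le> F u" using minkowski_norm_equiv by metis
  have "norm u \<le> r / c" if "F u \<le> r" for u
    using c(1) order_trans[OF c(2) that] by (simp add: field_simps)
  then have "cball 0 (r/c) \<inter> {u. F u \<le> r} = {u. F u \<le> r}" by auto
  moreover have "closed {u. F u \<le> r}"
    using minkowski_continuous by (intro closed_Collect_le) auto
  ultimately show ?thesis
    using compact_Int_closed[OF minkowski_compact_cball] by metis
qed

end

section \<open>Linear maps between Minkowski normed spaces\<close>

text \<open>Chaining \<open>c * norm (\<mu> u) \<le> F\<^sub>2 (\<mu> u) \<le> F\<^sub>1 u \<le> C *
  norm u\<close> bounds \<open>\<mu>\<close> by \<open>C / c\<close>. Continuity is what makes the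
  fibres closed.\<close>

lemma linear_minkowski_le_continuous:
  assumes F1: "minkowski_normed_space F\<^sub>1" and F2: "minkowski_normed_space F\<^sub>2"
    and "linear \<mu>" and le: "\<And>u. F\<^sub>2 (\<mu> u) \<le> F\<^sub>1 u"
  shows "continuous_on UNIV \<mu>"
proof -
  obtain c where c: "0 < c" "\<And>v. c * norm v \<le> F\<^sub>2 v" using minkowski_norm_equiv[OF F2] by metis
  obtain C where C: "\<And>u. F\<^sub>1 u \<le> C * norm u" using minkowski_norm_equiv[OF F1] by metis
  have "norm (\<mu> u) \<le> norm u * (C / c)" for u
  proof -
    have "c * norm (\<mu> u) \<le> C * norm u"
      using c(2)[of "\<mu> u"] le[of u] C[of u] by linarith
    then show ?thesis using c(1) by (simp add: field_simps)
  qed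
  then have "bounded_linear \<mu>"
    using \<open>linear \<mu>\<close> by (intro bounded_linear_intro) (simp_all only: linear_add linear_scale)
  then show ?thesis by (simp add: linear_continuous_on)
qed

text \<open>The fibre cut down to the sublevel set at \<open>w\<close> is compact and contains
  \<open>w\<close>. Its minimum is at most \<open>F w\<close>, hence also at most every value on the
  discarded part of the fibre.\<close>

lemma minkowski_fibre_inf_attained:
  fixes \<mu> :: "'a::real_normed_vector \<Rightarrow> 'b::t1_space"
  assumes F: "minkowski_normed_space F" and \<mu>: "continuous_on UNIV \<mu>"
    and ne: "\<mu> w = v"
  obtains u where "\<mu> u = v" "F u = (INF u\<in>{u. \<mu> u = v}. F u)"
proof -
  let ?K = "{u. F u \<le> F w} \<inter> {u. \<mu> u = v}"
  have "closed (\<mu> -` {v})" using \<mu> by (intro closed_vimage) auto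
  then have "compact ?K"
    using minkowski_compact_sublevel[OF F] by (intro compact_Int_closed) (simp_all add: vimage_def)
  moreover have "?K \<noteq> {}" using ne by auto
  ultimately obtain u where u: "u \<in> ?K" "\<And>x. x \<in> ?K \<Longrightarrow> F u \<le> F x"
    using continuous_attains_inf[of ?K F] continuous_on_subset[OF minkowski_continuous[OF F]]
    by blast
  have "F u \<le> F x" if "\<mu> x = v" for x
    using u that by (cases "F x \<le> F w") auto
  then have "(INF u\<in>{u. \<mu> u = v}. F u) = F u"
    using u(1) by (intro cInf_eq_minimum) auto
  then show ?thesis using that u(1) by auto
qed

text \<open>Nonzero vectors are normalised to value 1, where equality of the balls applies, and then
  scaled back; 0 is handled separately because the scaling divides by the value.\<close>

lemma image_closed_unit_ball_eq_iff:
  assumes F1: "minkowski_normed_space F\<^sub>1" and F2: "minkowski_normed_space F\<^sub>2"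
    and \<mu>: "linear \<mu>"
  shows "\<mu> ` closure (unit_ball F\<^sub>1) = closure (unit_ball F\<^sub>2) \<longleftrightarrow>
    (\<forall>u. F\<^sub>2 (\<mu> u) \<le> F\<^sub>1 u) \<and> (\<forall>v. \<exists>u. \<mu> u = v \<and> F\<^sub>1 u \<le> F\<^sub>2 v)"
    (is "_ \<longleftrightarrow> ?R")
proof -
  have "?R" if eq: "\<mu> ` {u. F\<^sub>1 u \<le> 1} = {v. F\<^sub>2 v \<le> 1}"
  proof (intro conjI allI)
    fix u
    show "F\<^sub>2 (\<mu> u) \<le> F\<^sub>1 u"
    proof (cases "u = 0")
      case True
      then show ?thesis using \<mu> by (simp add: linear_0 minkowski_zero F1 F2)
    next
      case False
      then have pos: "0 < F\<^sub>1 u" using minkowski_pos[OF F1] by blast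
      then have "F\<^sub>1 (u /\<^sub>R F\<^sub>1 u) \<le> 1" by (simp add: minkowski_scale[OF F1])
      then have "F\<^sub>2 (\<mu> (u /\<^sub>R F\<^sub>1 u)) \<le> 1" using eq by blast
      then have "F\<^sub>2 (\<mu> u) / F\<^sub>1 u \<le> 1"
        using pos \<mu> by (simp add: linear_scale minkowski_scale[OF F2] divide_inverse_commute)
      then show ?thesis using pos by simp
    qed
  next
    fix v
    show "\<exists>u. \<mu> u = v \<and> F\<^sub>1 u \<le> F\<^sub>2 v"
    proof (cases "v = 0")
      case True
      then show ?thesis using \<mu> by (intro exI[of _ 0]) (simp add: linear_0 minkowski_zero F1 F2)
    next
      case False
      then have pos: "0 < F\<^sub>2 v" using minkowski_pos[OF F2] by blast
      then have "F\<^sub>2 (v /\<^sub>R F\<^sub>2 v) \<le> 1" by (simp add: minkowski_scale[OF F2])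
      then obtain u where u: "F\<^sub>1 u \<le> 1" "v /\<^sub>R F\<^sub>2 v = \<mu> u" using eq by blast
      have "\<mu> (F\<^sub>2 v *\<^sub>R u) = v" using \<mu> pos by (simp add: linear_scale flip: u(2))
      moreover have "F\<^sub>1 (F\<^sub>2 v *\<^sub>R u) \<le> F\<^sub>2 v"
        using u(1) pos by (simp add: minkowski_scale[OF F1])
      ultimately show ?thesis by blast
    qed
  qed
  moreover have "\<mu> ` {u. F\<^sub>1 u \<le> 1} = {v. F\<^sub>2 v \<le> 1}" if R: "?R"
  proof
    show "\<mu> ` {u. F\<^sub>1 u \<le> 1} \<subseteq> {v. F\<^sub>2 v \<le> 1}" using R by (auto intro: order_trans)
    show "{v. F\<^sub>2 v \<le> 1} \<subseteq> \<mu> ` {u. F\<^sub>1 u \<le> 1}"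
    proof
      fix v assume "v \<in> {v. F\<^sub>2 v \<le> 1}"
      moreover obtain u where "\<mu> u = v" "F\<^sub>1 u \<le> F\<^sub>2 v" using R by blast
      ultimately show "v \<in> \<mu> ` {u. F\<^sub>1 u \<le> 1}" by force
    qed
  qed
  ultimately show ?thesis
    unfolding minkowski_closure_unit_ball[OF F1] minkowski_closure_unit_ball[OF F2] by (rule iffI)
qed

theorem proposition3:
  fixes F\<^sub>1 :: "'a::real_normed_vector \<Rightarrow> real"
    and F\<^sub>2 :: "'b::real_normed_vector \<Rightarrow> real"
    and \<mu> :: "'a \<Rightarrow> 'b"
  assumes "minkowski_normed_space F\<^sub>1"
    and "minkowski_normed_space F\<^sub>2"
    and "linear \<mu>" and "surj \<mu>"
  shows "(minkowski_submersion F\<^sub>1 F\<^sub>2 \<mu> \<longleftrightarrow>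
            \<mu> ` closure (unit_ball F\<^sub>1) = closure (unit_ball F\<^sub>2))
       \<and> (\<mu> ` closure (unit_ball F\<^sub>1) = closure (unit_ball F\<^sub>2) \<longleftrightarrow>
            (\<forall>v. F\<^sub>2 v = (INF u\<in>{u. \<mu> u = v}. F\<^sub>1 u)))"
proof -
  note F = assms(1,2) and \<mu> = assms(3)
  have "(\<forall>u. F\<^sub>2 (\<mu> u) \<le> F\<^sub>1 u) \<and> (\<forall>v. \<exists>u. \<mu> u = v \<and> F\<^sub>1 u \<le> F\<^sub>2 v) \<longleftrightarrow>
      (\<forall>v. F\<^sub>2 v = (INF u\<in>{u. \<mu> u = v}. F\<^sub>1 u))" (is "?R \<longleftrightarrow> ?I")
  proof
    assume R: ?R
    show ?I
    proof
      fix v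
      \<comment> \<open>The two halves of \<open>?R\<close> give opposite inequalities for this
        preimage, so the lower bound \<open>F\<^sub>2 v\<close> is attained on the fibre.\<close>
      obtain u where u: "\<mu> u = v" "F\<^sub>1 u = F\<^sub>2 v" using R by (metis order_antisym)
      then have "F\<^sub>2 v \<in> F\<^sub>1 ` {u. \<mu> u = v}" by force
      moreover have "F\<^sub>2 v \<le> x" if "x \<in> F\<^sub>1 ` {u. \<mu> u = v}" for x using that R by blast
      ultimately have "(INF u\<in>{u. \<mu> u = v}. F\<^sub>1 u) = F\<^sub>2 v" by (rule cInf_eq_minimum)
      then show "F\<^sub>2 v = (INF u\<in>{u. \<mu> u = v}. F\<^sub>1 u)" ..
    qed
  next
    assume I: ?I
    have le: "F\<^sub>2 (\<mu> u) \<le> F\<^sub>1 u" for u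
    proof -
      \<comment> \<open>A real \<open>INF\<close> is a lower bound only for sets bounded below; here
        0 is such a bound.\<close>
      have "(INF x\<in>{x. \<mu> x = \<mu> u}. F\<^sub>1 x) \<le> F\<^sub>1 u"
        using minkowski_nonneg[OF F(1)] by (intro cINF_lower) (auto intro!: bdd_belowI[of _ 0])
      then show ?thesis using I by simp
    qed
    moreover have "\<exists>u. \<mu> u = v \<and> F\<^sub>1 u \<le> F\<^sub>2 v" for v
    proof -
      \<comment> \<open>Surjectivity makes the fibre nonempty, and \<open>le\<close> supplies the
        continuity of \<open>\<mu>\<close> needed for attainment.\<close>
      obtain w where "\<mu> w = v" using \<open>surj \<mu>\<close> by (metis surjD)
      then obtain u where "\<mu> u = v" "F\<^sub>1 u = (INF u\<in>{u. \<mu> u = v}. F\<^sub>1 u)"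
        by (rule minkowski_fibre_inf_attained[OF F(1) linear_minkowski_le_continuous[OF F \<mu> le]])
      then show ?thesis using I by auto
    qed
    ultimately show ?R by blast
  qed
  then show ?thesis
    using image_closed_unit_ball_eq_iff[OF F \<mu>] assms(3,4) by (simp add: minkowski_submersion_def)
qed

end
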